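(* Let $G$ be a simple connected graph with $n\geq 3$ vertices, $m$ edges, and clique number $w$. Let $\delta$ denote the minimum edge neighborhood degree of $G$, and let $a>1$ be real. Then \[KB^a(G)\geq n\delta^a+\left(4m(2n-1)+2n^3\left(\frac{1}{w^2}-1\right)-n\delta\right)\bigl((\delta+1)^a-\delta^a\bigr),\] with equality if $G$ is regular of degree $k$ and $w=\frac{n}{n-k}$.
   Context: Graphs are finite. The clique number of a graph is the order (number of vertices) of a largest complete subgraph. For a simple graph $G$ with vertex set $V(G)$, $d(u)$ denotes the degree of a vertex $u$. The degree of an edge $e=uv$ is $d_G(e)=d(u)+d(v)-2$. The edge neighborhood degree $S_e(v)$ of a vertex $v$ is the sum of the degrees $d_G(e)$ of all edges $e$ incident to $v$. For real $a\neq 0,1$, the general Kulli-Basava index is $KB^a(G)=\sum_{v\in V(G)}S_e(v)^a$. *)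

theory Defs
  imports Complex_Main "Graph_Theory.Graph_Theory"
begin

text \<open>
  A finite simple graph is a \<open>graph\<close> in the sense of the Graph_Theory entry: a finite,
  loop-free digraph without parallel arcs whose arc relation is symmetric. Each undirected edge
  is thus represented by two opposite arcs, which are identified again in \<open>uedges\<close>.
\<close>

definition uedges :: "('a, 'b) pre_digraph \<Rightarrow> 'a set set" where
  "uedges G = (\<lambda>x. {tail G x, head G x}) ` arcs G"

definition incident_edges :: "('a, 'b) pre_digraph \<Rightarrow> 'a \<Rightarrow> 'a set set" where
  "incident_edges G v = {e \<in> uedges G. v \<in> e}"

definition degree :: "('a, 'b) pre_digraph \<Rightarrow> 'a \<Rightarrow> nat" where
  "degree G v = card (incident_edges G v)"

text \<open>
  For an edge \<open>e = {u, v}\<close> of a simple graph this is \<open>d(u) + d(v) - 2\<close>. The subtraction on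
  natural numbers does not truncate, as both endpoints of an edge have degree at least 1.
\<close>

definition edge_degree :: "('a, 'b) pre_digraph \<Rightarrow> 'a set \<Rightarrow> nat" where
  "edge_degree G e = (\<Sum>u\<in>e. degree G u) - 2"

definition edge_nbhd_degree :: "('a, 'b) pre_digraph \<Rightarrow> 'a \<Rightarrow> nat" where
  "edge_nbhd_degree G v = (\<Sum>e\<in>incident_edges G v. edge_degree G e)"

definition min_edge_nbhd_degree :: "('a, 'b) pre_digraph \<Rightarrow> nat" where
  "min_edge_nbhd_degree G = Min (edge_nbhd_degree G ` verts G)"

text \<open>
  The index is meant for \<open>a\<close> different from 0 and 1. For negative \<open>a\<close>, vertices with edge
  neighborhood degree 0 contribute 0, since \<open>0 powr a = 0\<close>.
\<close>

definition KB_index :: "real \<Rightarrow> ('a, 'b) pre_digraph \<Rightarrow> real" where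
  "KB_index a G = (\<Sum>v\<in>verts G. real (edge_nbhd_degree G v) powr a)"

definition clique_number :: "('a, 'b) pre_digraph \<Rightarrow> nat" where
  "clique_number G =
     Max {card (verts H) | H. subgraph H G \<and> complete_digraph (card (verts H)) H}"

definition regular :: "nat \<Rightarrow> ('a, 'b) pre_digraph \<Rightarrow> bool" where
  "regular k G \<longleftrightarrow> (\<forall>v\<in>verts G. degree G v = k)"

end

theory Submission
  imports Defs
begin

text \<open>
  Write \<open>S v\<close> for the edge neighborhood degree of \<open>v\<close> and \<open>d v\<close> for its degree. Two independent
  estimates meet in the sum of all \<open>S v\<close>.

  Convexity of \<open>x powr a\<close> places its value at every integer \<open>s \<ge> \<delta>\<close> on or above the line through
  its values at \<open>\<delta>\<close> and \<open>\<delta> + 1\<close> (\<open>powr_ge_chord\<close>). Adding this up over the vertices bounds the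
  index below by \<open>n * \<delta> powr a\<close> plus \<open>((\<Sum>v. S v) - n * \<delta>)\<close> times the slope of that line. So
  it remains to see that \<open>\<Sum>v. S v\<close> is at least the expression
  \<open>4m(2n - 1) + 2n^3(1/w^2 - 1)\<close>.

  Counting each edge from both of its ends gives \<open>(\<Sum>v. S v) = 2 (\<Sum>v. (d v)^2) - 4m\<close>. As the
  degrees add up to \<open>2m\<close>, completing the square turns the required inequality into
  \<open>(\<Sum>v. (n - d v)^2) \<ge> n^3 / w^2\<close>, a form of Turan's theorem. It follows from the Caro-Wei bound
  \<open>(\<Sum>v. 1 / (n - d v)) \<le> w\<close> (\<open>caro_wei_clique\<close>) and a power mean inequality
  (\<open>sum_squares_ge_of_sum_inverse_le\<close>).

  If \<open>G\<close> is \<open>k\<close>-regular, then every \<open>S v\<close> equals \<open>\<delta> = k(2k - 2)\<close>, so the index is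
  \<open>n * \<delta> powr a\<close>. If moreover \<open>w = n / (n - k)\<close>, then \<open>n^3 / w^2 = n(n - k)^2\<close>, which makes the
  factor in front of the slope vanish.
\<close>

section \<open>Cliques and non-neighbours\<close>

text \<open>
  This is the greedy proof. A vertex \<open>v\<close> with the fewest non-neighbours is joined to a clique found
  recursively among its neighbours. Shrinking the vertex set to the neighbours of \<open>v\<close> only lowers
  the non-neighbour counts, so the recursive clique is at least as large as the part of the sum
  that belongs to the neighbours. The discarded vertices are the non-neighbours of \<open>v\<close>, and by the
  choice of \<open>v\<close> each of them contributes at most the reciprocal of their number: at most 1 in
  total, which \<open>v\<close> itself pays for. Each vertex counts as its own non-neighbour, so no denominator
  vanishes.
\<close>

lemma caro_wei_clique:
  fixes V :: "'v set" and E :: "'v \<Rightarrow> 'v \<Rightarrow> bool"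
  assumes "finite V" and sym: "\<And>x y. E x y \<Longrightarrow> E y x" and irr: "\<And>x. \<not> E x x"
  shows "\<exists>K\<subseteq>V. (\<forall>x\<in>K. \<forall>y\<in>K. x \<noteq> y \<longrightarrow> E x y) \<and>
           (\<Sum>u\<in>V. 1 / real (card {x\<in>V. \<not> E u x})) \<le> real (card K)"
  using \<open>finite V\<close>
proof (induction V rule: finite_psubset_induct)
  case (psubset V)
  show ?case
  proof (cases "V = {}")
    case True
    then show ?thesis by auto
  next
    case False
    define nn where "nn u = card {x\<in>V. \<not> E u x}" for u
    obtain v where v: "v \<in> V" and vmin: "\<And>u. u \<in> V \<Longrightarrow> nn v \<le> nn u"
      using ex_min_if_finite[of "nn ` V"] False psubset.hyps
      by (metis (no_types, lifting) arg_min_if_finite(1) arg_min_least)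
    define N where "N = {x\<in>V. E v x}"
    define B where "B = {x\<in>V. \<not> E v x}"
    have fin: "finite N" "finite B" using psubset.hyps by (auto simp: N_def B_def)
    have V: "V = N \<union> B" "N \<inter> B = {}" by (auto simp: N_def B_def)
    have "v \<in> B" using v irr by (auto simp: B_def)
    then have "N \<subset> V" using V by blast
    from psubset.IH[OF this] obtain K where K: "K \<subseteq> N"
      "\<forall>x\<in>K. \<forall>y\<in>K. x \<noteq> y \<longrightarrow> E x y"
      "(\<Sum>u\<in>N. 1 / real (card {x\<in>N. \<not> E u x})) \<le> real (card K)" by blast
    have finK: "finite K" using K(1) fin(1) by (rule finite_subset)
    have "v \<notin> K" using K(1) irr by (auto simp: N_def)
    then have card: "card (insert v K) = Suc (card K)" using finK by simp
    have "(\<Sum>u\<in>N. 1 / real (nn u)) \<le> (\<Sum>u\<in>N. 1 / real (card {x\<in>N. \<not> E u x}))"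
    proof (rule sum_mono)
      fix u assume u: "u \<in> N"
      have "card {x\<in>N. \<not> E u x} \<le> nn u"
        unfolding nn_def using psubset.hyps by (intro card_mono) (auto simp: N_def)
      moreover have "u \<in> {x\<in>N. \<not> E u x}" using u irr by auto
      then have "card {x\<in>N. \<not> E u x} > 0" using fin(1) by (auto simp: card_gt_0_iff)
      ultimately show "1 / real (nn u) \<le> 1 / real (card {x\<in>N. \<not> E u x})"
        by (intro divide_left_mono) auto
    qed
    also have "\<dots> \<le> real (card K)" by (rule K(3))
    finally have N_le: "(\<Sum>u\<in>N. 1 / real (nn u)) \<le> real (card K)" .
    have nnv: "nn v = card B" by (simp add: nn_def B_def)
    have pos: "card B > 0" using \<open>v \<in> B\<close> fin(2) by (auto simp: card_gt_0_iff)
    have "(\<Sum>u\<in>B. 1 / real (nn u)) \<le> (\<Sum>u\<in>B. 1 / real (card B))"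
    proof (rule sum_mono)
      fix u assume "u \<in> B"
      then have "card B \<le> nn u" using vmin[of u] V nnv by auto
      then show "1 / real (nn u) \<le> 1 / real (card B)"
        using pos by (intro divide_left_mono) auto
    qed
    also have "\<dots> = 1" using pos by simp
    finally have B_le: "(\<Sum>u\<in>B. 1 / real (nn u)) \<le> 1" .
    have "(\<Sum>u\<in>V. 1 / real (nn u)) \<le> real (card (insert v K))"
      using N_le B_le card fin V(2) by (subst V(1), subst sum.union_disjoint) auto
    moreover have "\<forall>x\<in>insert v K. \<forall>y\<in>insert v K. x \<noteq> y \<longrightarrow> E x y"
      using K(1,2) sym by (auto simp: N_def)
    moreover have "insert v K \<subseteq> V" using v K(1) V by auto
    ultimately show ?thesis unfolding nn_def by blast
  qed
qed

text \<open>
  For each value \<open>x\<close> of \<open>f\<close>, the arithmetic-geometric mean inequality for \<open>x\<^sup>2\<close>, \<open>t^3 / x\<close>, \<open>t^3 / x\<close>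
  bounds \<open>x\<^sup>2\<close> below by an affine function of \<open>1 / x\<close>, with equality at \<open>x = t\<close>. The constant
  \<open>t = card V / w\<close> is the common value that \<open>f\<close> takes in the extremal case.
\<close>

lemma sum_squares_ge_of_sum_inverse_le:
  fixes f :: "'v \<Rightarrow> real" and w :: real
  assumes pos: "\<And>v. v \<in> V \<Longrightarrow> f v > 0" and "w > 0"
    and le: "(\<Sum>v\<in>V. 1 / f v) \<le> w"
  shows "real (card V) ^ 3 / w\<^sup>2 \<le> (\<Sum>v\<in>V. (f v)\<^sup>2)"
proof -
  define t where "t = real (card V) / w"
  have t: "t \<ge> 0" using \<open>w > 0\<close> by (simp add: t_def)
  have tangent: "3 * t\<^sup>2 - 2 * t ^ 3 * (1 / x) \<le> x\<^sup>2" if "x > 0" for x :: real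
  proof -
    have "0 \<le> (x - t)\<^sup>2 * (x + 2 * t)" using that t by simp
    also have "\<dots> = x ^ 3 + 2 * t ^ 3 - 3 * t\<^sup>2 * x"
      by (simp add: algebra_simps power2_eq_square power3_eq_cube)
    finally show ?thesis
      using that by (simp add: field_simps power2_eq_square power3_eq_cube)
  qed
  have "real (card V) ^ 3 / w\<^sup>2 = 3 * t\<^sup>2 * real (card V) - 2 * t ^ 3 * w"
    using \<open>w > 0\<close> by (simp add: t_def field_simps power2_eq_square power3_eq_cube)
  also have "\<dots> \<le> 3 * t\<^sup>2 * real (card V) - 2 * t ^ 3 * (\<Sum>v\<in>V. 1 / f v)"
    using le t by (intro diff_left_mono mult_left_mono) auto
  also have "\<dots> = (\<Sum>v\<in>V. 3 * t\<^sup>2 - 2 * t ^ 3 * (1 / f v))"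
    by (simp add: sum_subtractf sum_distrib_left)
  also have "\<dots> \<le> (\<Sum>v\<in>V. (f v)\<^sup>2)" using pos by (intro sum_mono tangent)
  finally show ?thesis .
qed

section \<open>Degrees in symmetric digraphs\<close>

abbreviation nbhd :: "('a, 'b) pre_digraph \<Rightarrow> 'a \<Rightarrow> 'a set" where
  "nbhd G v \<equiv> {u. v \<rightarrow>\<^bsub>G\<^esub> u}"

context graph
begin

lemma finite_nbhd: "finite (nbhd G v)"
  by (rule finite_subset[OF _ finite_verts]) (auto dest: adj_in_verts)

lemma adj_sym: "u \<rightarrow>\<^bsub>G\<^esub> v \<Longrightarrow> v \<rightarrow>\<^bsub>G\<^esub> u"
  using sym_arcs by (auto simp: symmetric_def dest: symD)

lemma not_adj_self: "\<not> v \<rightarrow>\<^bsub>G\<^esub> v"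
  using adj_not_same by blast

lemma uedges_conv: "uedges G = {{u, v} | u v. u \<rightarrow>\<^bsub>G\<^esub> v}"
  by (auto simp: uedges_def arcs_ends_def arc_to_ends_def)

lemma incident_edges_conv: "incident_edges G v = (\<lambda>u. {v, u}) ` nbhd G v"
  by (auto simp: incident_edges_def uedges_conv doubleton_eq_iff intro: adj_sym)

lemma inj_on_edge: "inj_on (\<lambda>u. {v, u}) A"
  by (auto simp: inj_on_def doubleton_eq_iff)

lemma degree_eq_card_nbhd: "degree G v = card (nbhd G v)"
  by (simp add: degree_def incident_edges_conv card_image inj_on_edge)

lemma degree_pos: "u \<rightarrow>\<^bsub>G\<^esub> v \<Longrightarrow> degree G u > 0"
  using finite_nbhd by (auto simp: degree_eq_card_nbhd card_gt_0_iff)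

lemma non_nbhd_card:
  assumes "v \<in> verts G"
  shows "real (card {x \<in> verts G. \<not> v \<rightarrow>\<^bsub>G\<^esub> x})
           = real (card (verts G)) - real (degree G v)"
    and "card {x \<in> verts G. \<not> v \<rightarrow>\<^bsub>G\<^esub> x} > 0"
proof -
  have *: "nbhd G v \<subseteq> verts G" by (auto dest: adj_in_verts)
  have "{x \<in> verts G. \<not> v \<rightarrow>\<^bsub>G\<^esub> x} = verts G - nbhd G v" by auto
  then have "card {x \<in> verts G. \<not> v \<rightarrow>\<^bsub>G\<^esub> x} = card (verts G) - degree G v"
    using card_Diff_subset[OF finite_nbhd *] by (simp add: degree_eq_card_nbhd)
  moreover have "degree G v \<le> card (verts G)"
    using * by (simp add: degree_eq_card_nbhd card_mono)
  ultimately show "real (card {x \<in> verts G. \<not> v \<rightarrow>\<^bsub>G\<^esub> x})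
      = real (card (verts G)) - real (degree G v)"
    by simp
  have "v \<in> {x \<in> verts G. \<not> v \<rightarrow>\<^bsub>G\<^esub> x}" using assms not_adj_self by simp
  then show "card {x \<in> verts G. \<not> v \<rightarrow>\<^bsub>G\<^esub> x} > 0" by (auto simp: card_gt_0_iff)
qed

lemma handshake: "(\<Sum>v\<in>verts G. degree G v) = 2 * card (uedges G)"
  unfolding degree_def incident_edges_def
proof (rule sum_multicount)
  show "\<forall>e\<in>uedges G. card {v \<in> verts G. v \<in> e} = 2"
  proof
    fix e assume "e \<in> uedges G"
    then obtain u v where e: "e = {u, v}" "u \<rightarrow>\<^bsub>G\<^esub> v" by (auto simp: uedges_conv)
    then have "u \<noteq> v" using not_adj_self by auto
    moreover have "{x \<in> verts G. x \<in> e} = {u, v}" using e by (auto dest: adj_in_verts)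
    ultimately show "card {v \<in> verts G. v \<in> e} = 2" by simp
  qed
qed (auto simp: uedges_def)

lemma edge_nbhd_degree_conv:
  "real (edge_nbhd_degree G v) = (\<Sum>u\<in>nbhd G v. real (degree G v) + real (degree G u) - 2)"
proof -
  have "edge_nbhd_degree G v = (\<Sum>u\<in>nbhd G v. edge_degree G {v, u})"
    unfolding edge_nbhd_degree_def incident_edges_conv
    by (subst sum.reindex) (auto simp: inj_on_edge)
  moreover have "real (edge_degree G {v, u}) = real (degree G v) + real (degree G u) - 2"
    if "v \<rightarrow>\<^bsub>G\<^esub> u" for u
  proof -
    have "v \<noteq> u" using that not_adj_self by auto
    moreover have "degree G v > 0" "degree G u > 0"
      using that by (auto intro: degree_pos adj_sym)
    ultimately show ?thesis by (simp add: edge_degree_def of_nat_diff)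
  qed
  ultimately show ?thesis by simp
qed

text \<open>
  In the double sum of \<open>d v + d u - 2\<close> over ordered adjacent pairs, the roles of \<open>v\<close> and \<open>u\<close> can be
  exchanged, so both degree terms give the sum of the squared degrees.
\<close>

lemma sum_edge_nbhd_degree:
  "(\<Sum>v\<in>verts G. real (edge_nbhd_degree G v))
     = 2 * (\<Sum>v\<in>verts G. (real (degree G v))\<^sup>2) - 4 * real (card (uedges G))"
proof -
  have nb: "nbhd G v = {u \<in> verts G. v \<rightarrow>\<^bsub>G\<^esub> u}" for v by (auto dest: adj_in_verts)
  have "(\<Sum>v\<in>verts G. \<Sum>u\<in>nbhd G v. real (degree G u))
      = (\<Sum>u\<in>verts G. \<Sum>v | v \<in> verts G \<and> v \<rightarrow>\<^bsub>G\<^esub> u. real (degree G u))"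
    unfolding nb by (rule sum.swap_restrict) auto
  also have "\<dots> = (\<Sum>u\<in>verts G. \<Sum>v\<in>nbhd G u. real (degree G u))"
    unfolding nb by (intro sum.cong) (auto intro: adj_sym)
  finally have swap: "(\<Sum>v\<in>verts G. \<Sum>u\<in>nbhd G v. real (degree G u))
      = (\<Sum>v\<in>verts G. (real (degree G v))\<^sup>2)"
    by (simp add: degree_eq_card_nbhd power2_eq_square)
  have "(\<Sum>v\<in>verts G. real (edge_nbhd_degree G v))
      = (\<Sum>v\<in>verts G. (real (degree G v))\<^sup>2 - 2 * real (degree G v)
           + (\<Sum>u\<in>nbhd G v. real (degree G u)))"
    by (intro sum.cong refl)
      (simp add: edge_nbhd_degree_conv sum.distrib sum_subtractf
        degree_eq_card_nbhd[symmetric] power2_eq_square)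
  also have "\<dots> = 2 * (\<Sum>v\<in>verts G. (real (degree G v))\<^sup>2) - 2 * real (\<Sum>v\<in>verts G. degree G v)"
    by (simp add: sum.distrib sum_subtractf swap sum_distrib_left)
  finally show ?thesis by (simp add: handshake)
qed

section \<open>The clique number\<close>

text \<open>
  The clique number is defined through complete subgraphs; the subgraph induced on a set of pairwise
  adjacent vertices is one.
\<close>

lemma card_clique_le_clique_number:
  assumes "K \<subseteq> verts G" and "\<forall>x\<in>K. \<forall>y\<in>K. x \<noteq> y \<longrightarrow> x \<rightarrow>\<^bsub>G\<^esub> y"
  shows "card K \<le> clique_number G"
proof -
  let ?H = "G \<restriction> K"
  have ind: "induced_subgraph ?H G" using assms(1) by (rule induced_induce)
  interpret H: digraph ?H using ind by (rule digraphI_induced)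
  interpret H': sym_digraph ?H using ind by (rule induced_graph_imp_graph)
  have "graph ?H" by unfold_locales
  moreover have "arcs_ends ?H = {(u, v). (u, v) \<in> K \<times> K \<and> u \<noteq> v}"
  proof (intro set_eqI iffI; clarsimp)
    fix u v assume *: "u \<rightarrow>\<^bsub>?H\<^esub> v"
    then have "u \<noteq> v" using H.adj_not_same by blast
    then show "u \<in> K \<and> v \<in> K \<and> u \<noteq> v" using H.adj_in_verts[OF *] by simp
  next
    fix u v assume "u \<in> K" "v \<in> K" "u \<noteq> v"
    then have "u \<rightarrow>\<^bsub>G\<^esub> v" using assms(2) by blast
    with \<open>u \<in> K\<close> \<open>v \<in> K\<close> show "u \<rightarrow>\<^bsub>?H\<^esub> v"
      by (auto simp: arcs_ends_def arc_to_ends_def)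
  qed
  ultimately have "complete_digraph (card (verts ?H)) ?H"
    by (simp add: complete_digraph_def)
  moreover have "subgraph ?H G" using ind by (rule induced_imp_subgraph)
  ultimately have "card (verts ?H)
      \<in> {card (verts H) | H. subgraph H G \<and> complete_digraph (card (verts H)) H}"
    by blast
  moreover have
    "finite {card (verts H) | H. subgraph H G \<and> complete_digraph (card (verts H)) H}"
    by (rule finite_subset[of _ "{..card (verts G)}"]) (auto intro!: card_mono)
  ultimately have "card (verts ?H) \<le> clique_number G"
    unfolding clique_number_def by (rule Max_ge[rotated])
  then show ?thesis by simp
qed

text \<open>
  The Caro-Wei bound applies because \<open>n - d v\<close> is the number of non-neighbours of \<open>v\<close>, with \<open>v\<close>
  included.
\<close>

lemma sum_codegree_squares_ge:
  "real (card (verts G)) ^ 3 / (real (clique_number G))\<^sup>2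
     \<le> (\<Sum>v\<in>verts G. (real (card (verts G)) - real (degree G v))\<^sup>2)"
proof (cases "verts G = {}")
  case True
  then show ?thesis by simp
next
  case False
  let ?f = "\<lambda>v. real (card (verts G)) - real (degree G v)"
  obtain v where "v \<in> verts G" using False by blast
  then have w: "clique_number G \<ge> 1"
    using card_clique_le_clique_number[of "{v}"] by simp
  obtain K where "K \<subseteq> verts G" "\<forall>x\<in>K. \<forall>y\<in>K. x \<noteq> y \<longrightarrow> x \<rightarrow>\<^bsub>G\<^esub> y"
    "(\<Sum>u\<in>verts G. 1 / real (card {x\<in>verts G. \<not> u \<rightarrow>\<^bsub>G\<^esub> x})) \<le> real (card K)"
    using caro_wei_clique[OF finite_verts, of "\<lambda>u v. u \<rightarrow>\<^bsub>G\<^esub> v"] adj_sym not_adj_self by blast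
  then have "(\<Sum>u\<in>verts G. 1 / ?f u) \<le> real (clique_number G)"
    using card_clique_le_clique_number[of K] non_nbhd_card(1) by (simp cong: sum.cong)
  moreover have "?f v > 0" if "v \<in> verts G" for v
    using non_nbhd_card[OF that] by linarith
  ultimately show ?thesis
    using w by (intro sum_squares_ge_of_sum_inverse_le) auto
qed

lemma sum_edge_nbhd_degree_ge:
  fixes n m w :: real
  defines "n \<equiv> real (card (verts G))" and "m \<equiv> real (card (uedges G))"
    and "w \<equiv> real (clique_number G)"
  shows "4 * m * (2 * n - 1) + 2 * n ^ 3 * (1 / w\<^sup>2 - 1)
           \<le> (\<Sum>v\<in>verts G. real (edge_nbhd_degree G v))"
proof -
  have "(\<Sum>v\<in>verts G. (n - real (degree G v))\<^sup>2)
      = (\<Sum>v\<in>verts G. n\<^sup>2 - 2 * n * real (degree G v) + (real (degree G v))\<^sup>2)"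
    by (simp add: power2_diff algebra_simps)
  also have "\<dots> = n ^ 3 - 2 * n * real (\<Sum>v\<in>verts G. degree G v)
      + (\<Sum>v\<in>verts G. (real (degree G v))\<^sup>2)"
    by (simp add: sum.distrib sum_subtractf sum_distrib_left n_def power2_eq_square power3_eq_cube)
  finally have "n ^ 3 / w\<^sup>2 \<le> n ^ 3 - 4 * n * m + (\<Sum>v\<in>verts G. (real (degree G v))\<^sup>2)"
    using sum_codegree_squares_ge by (simp add: handshake n_def m_def w_def)
  then show ?thesis
    unfolding sum_edge_nbhd_degree m_def[symmetric] by (simp add: algebra_simps)
qed

lemma edge_nbhd_degree_regular:
  assumes "regular k G" and "v \<in> verts G"
  shows "real (edge_nbhd_degree G v) = real k * (2 * real k - 2)"
proof -
  have "degree G u = k" if "u \<in> verts G" for u using assms(1) that by (simp add: regular_def)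
  then have "(\<Sum>u\<in>nbhd G v. real (degree G v) + real (degree G u) - 2)
      = (\<Sum>u\<in>nbhd G v. 2 * real k - 2)"
    using assms(2) by (intro sum.cong) (auto dest: adj_in_verts)
  also have "\<dots> = real (degree G v) * (2 * real k - 2)"
    by (simp add: degree_eq_card_nbhd)
  finally show ?thesis
    using assms by (simp add: edge_nbhd_degree_conv regular_def)
qed

end

section \<open>The chord bound for powers\<close>

text \<open>
  The derivative of the increment is nonnegative because \<open>t powr (a - 1)\<close> is increasing. The
  derivative rule for \<open>powr\<close> applies at positive arguments only; if \<open>x = 0\<close>, continuity takes over
  at that endpoint.
\<close>

lemma powr_increment_mono:
  fixes a x y :: real
  assumes "a > 1" and "0 \<le> x" and "x \<le> y"
  shows "(x + 1) powr a - x powr a \<le> (y + 1) powr a - y powr a"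
proof (rule DERIV_nonneg_imp_increasing_open[OF \<open>x \<le> y\<close>])
  fix t assume "x < t" "t < y"
  then have t: "t > 0" using assms by simp
  have "((\<lambda>t. (t + 1) powr a - t powr a) has_real_derivative
      a * ((t + 1) powr (a - 1) - t powr (a - 1))) (at t)"
    using t by (auto intro!: derivative_eq_intros simp: algebra_simps)
  moreover have "t powr (a - 1) \<le> (t + 1) powr (a - 1)"
    using t assms by (intro powr_mono2) auto
  ultimately show "\<exists>D. ((\<lambda>t. (t + 1) powr a - t powr a) has_real_derivative D) (at t) \<and> 0 \<le> D"
    using assms by (intro exI[of _ "a * ((t + 1) powr (a - 1) - t powr (a - 1))"] conjI) auto
next
  show "continuous_on {x..y} (\<lambda>t. (t + 1) powr a - t powr a)"
    using assms by (intro continuous_intros continuous_on_powr') auto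
qed

text \<open>
  From \<open>d\<close> to \<open>s\<close> there are \<open>s - d\<close> unit increments, and the first of them is the smallest. The
  bound fails for reals strictly between \<open>d\<close> and \<open>d + 1\<close>, where the strictly convex power lies
  below its chord: it depends on \<open>s\<close> being an integer.
\<close>

lemma powr_ge_chord:
  fixes s d :: nat and a :: real
  assumes "a > 1" and "d \<le> s"
  shows "real d powr a + (real s - real d) * ((real d + 1) powr a - real d powr a)
           \<le> real s powr a"
  using \<open>d \<le> s\<close>
proof (induction s rule: dec_induct)
  case base
  then show ?case by simp
next
  case (step s)
  have "(real d + 1) powr a - real d powr a \<le> (real s + 1) powr a - real s powr a"
    using assms(1) step.hyps by (intro powr_increment_mono) auto
  with step.IH show ?case by (simp add: algebra_simps)
qed

section \<open>The bound on the general Kulli-Basava index\<close>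

theorem corollary3p9:
  fixes G :: "('a, 'b) pre_digraph" and n m w \<delta> :: nat and a :: real
  assumes "graph G" and "Digraph_Component.connected G"
    and "n = card (verts G)" and "n \<ge> 3"
    and "m = card (uedges G)"
    and "w = clique_number G"
    and "\<delta> = min_edge_nbhd_degree G"
    and "a > 1"
  shows "KB_index a G \<ge> real n * real \<delta> powr a
           + (4 * real m * (2 * real n - 1) + 2 * real n ^ 3 * (1 / real w ^ 2 - 1)
                - real n * real \<delta>) * ((real \<delta> + 1) powr a - real \<delta> powr a)
         \<and> (\<forall>k. regular k G \<and> real w = real n / (real n - real k) \<longrightarrow>
              KB_index a G = real n * real \<delta> powr a
                + (4 * real m * (2 * real n - 1) + 2 * real n ^ 3 * (1 / real w ^ 2 - 1)
                     - real n * real \<delta>) * ((real \<delta> + 1) powr a - real \<delta> powr a))"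
proof -
  interpret graph G by fact
  define D where "D = (real \<delta> + 1) powr a - real \<delta> powr a"
  define L where "L = 4 * real m * (2 * real n - 1) + 2 * real n ^ 3 * (1 / real w ^ 2 - 1)"
  let ?S = "edge_nbhd_degree G"
  have D: "D \<ge> 0" using \<open>a > 1\<close> by (simp add: D_def powr_mono2)
  have \<delta>_le: "\<delta> \<le> ?S v" if "v \<in> verts G" for v
    using that by (simp add: assms min_edge_nbhd_degree_def)
  have L: "L \<le> (\<Sum>v\<in>verts G. real (?S v))"
    using sum_edge_nbhd_degree_ge by (simp add: L_def assms)
  have "real n * real \<delta> powr a + (L - real n * real \<delta>) * D
      \<le> real n * real \<delta> powr a + ((\<Sum>v\<in>verts G. real (?S v)) - real n * real \<delta>) * D"
    using L D by (intro add_left_mono mult_right_mono) auto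
  also have "\<dots> = (\<Sum>v\<in>verts G. real \<delta> powr a + (real (?S v) - real \<delta>) * D)"
    by (simp add: sum.distrib sum_subtractf sum_distrib_right[symmetric] \<open>n = card (verts G)\<close>)
  also have "\<dots> \<le> KB_index a G"
    unfolding KB_index_def D_def using \<open>a > 1\<close> \<delta>_le by (intro sum_mono powr_ge_chord) auto
  finally have bound: "real n * real \<delta> powr a + (L - real n * real \<delta>) * D \<le> KB_index a G" .
  have eq: "KB_index a G = real n * real \<delta> powr a + (L - real n * real \<delta>) * D"
    if reg: "regular k G" and w: "real w = real n / (real n - real k)" for k
  proof -
    obtain v where v: "v \<in> verts G" using \<open>n = card (verts G)\<close> \<open>n \<ge> 3\<close> by fastforce
    define s where "s = ?S v"
    have S: "?S u = s" if "u \<in> verts G" for u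
    proof -
      have "real (?S u) = real s"
        unfolding s_def by (simp only: edge_nbhd_degree_regular[OF reg] v that)
      then show ?thesis by simp
    qed
    then have "?S ` verts G = {s}" using v by auto
    then have "\<delta> = s"
      by (simp add: \<open>\<delta> = min_edge_nbhd_degree G\<close> min_edge_nbhd_degree_def)
    then have \<delta>: "real \<delta> = real k * (2 * real k - 2)"
      using edge_nbhd_degree_regular[OF reg v] by (simp add: s_def)
    have "KB_index a G = real n * real \<delta> powr a"
      using S \<open>\<delta> = s\<close> by (simp add: KB_index_def \<open>n = card (verts G)\<close>)
    moreover have "n * k = 2 * m"
      using handshake reg
      by (simp add: regular_def \<open>n = card (verts G)\<close> \<open>m = card (uedges G)\<close>)
    then have m: "2 * real m = real n * real k"
      by (metis of_nat_mult of_nat_numeral)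
    have "real n > real k"
      using non_nbhd_card[OF v] reg v by (simp add: regular_def \<open>n = card (verts G)\<close>)
    then have "1 / real w ^ 2 = (real n - real k)\<^sup>2 / (real n)\<^sup>2"
      by (simp add: w power_divide)
    then have "real n ^ 3 * (1 / real w ^ 2) = real n * (real n - real k)\<^sup>2"
      using \<open>n \<ge> 3\<close> by (simp add: power2_eq_square power3_eq_cube)
    then have "L = 2 * (2 * real m) * (2 * real n - 1)
        + 2 * (real n * (real n - real k)\<^sup>2) - 2 * real n ^ 3"
      by (simp add: L_def algebra_simps)
    then have "L = real n * real \<delta>"
      unfolding m \<delta> by (simp add: algebra_simps power2_eq_square power3_eq_cube)
    ultimately show ?thesis by simp
  qed
  show ?thesis using bound eq unfolding L_def D_def by blast
qed

end
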